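(* Let $G=G_1*_HG_2$ be an amalgamated free product of groups $G_1$ and $G_2$ over a proper subgroup $H$ (proper in each of $G_1$ and $G_2$) such that $|G_1:H|\le 2$ and $|G_2:H|\le 2$, and let $m\ge 0$ be an integer. Then $\mathrm{pw}_m(G,G_1\cup G_2)$ is finite.
   Context: Amalgamated free product: given groups $G_1,G_2$ with subgroups $H_1\le G_1$, $H_2\le G_2$ and an isomorphism $\phi:H_1\to H_2$, the amalgamated free product is $\langle G_1,G_2\mid \phi(h)=h,\ h\in H_1\rangle$; since $H_1$ and $H_2$ are identified, they are denoted by $H$ and the group by $G_1*_HG_2$. Let $G$ be a group with generating set $X$. A reduced word $w$ in the alphabet $X^{\pm1}$ is called a palindrome if it reads the same left-to-right and right-to-left. An element $g\in G$ is called a palindrome if there exists a word in $X^{\pm1}$ representing $g$ that is a palindrome. For an integer $m\ge 0$, an element $g\in G$ is an $m$-almost palindrome if some word in $X^{\pm1}$ representing $g$ differs from a palindrome by a change of at most $m$ letters in $X^{\pm1}$. $\mathcal{P}_m(X)$ denotes the set of all $m$-almost palindromes in $G$. The $m$-almost palindromic length $l_{\mathcal{P}_m}(g)$ of $g\in G$ is the minimum $k$ such that $g=p_1p_2\cdots p_k$ with each $p_i\in\mathcal{P}_m(X)$. The $m$-almost palindromic width of $G$ with respect to $X$ is $\mathrm{pw}_m(G,X)=\sup_{g\in G} l_{\mathcal{P}_m}(g)$. *)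

theory Defs
  imports "HOL-Algebra.Algebra" "HOL-Library.Extended_Nat"
begin

subsection \<open>Amalgamated free products\<close>

text \<open>
  The group presented by \<open>\<langle>G\<^sub>1, G\<^sub>2 | \<phi>(h) = h, h \<in> H\<^sub>1\<rangle>\<close>: words over the disjoint union of the two
  carriers modulo the congruence generated by the multiplication tables of the two groups and the
  relations \<open>h = \<phi>(h)\<close>. No formal inverse letters are needed, since the letter
  \<open>x\<inverse>\<close> of \<open>G\<^sub>i\<close> becomes inverse to the letter \<open>x\<close>.
\<close>

definition amalg_words ::
    "('a, 'c) monoid_scheme \<Rightarrow> ('b, 'd) monoid_scheme \<Rightarrow> ('a + 'b) list set" where
  "amalg_words G1 G2 = lists (Sum_Type.Plus (carrier G1) (carrier G2))"

inductive amalg_eq ::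
    "('a, 'c) monoid_scheme \<Rightarrow> ('b, 'd) monoid_scheme \<Rightarrow> 'a set \<Rightarrow> ('a \<Rightarrow> 'b)
      \<Rightarrow> ('a + 'b) list \<Rightarrow> ('a + 'b) list \<Rightarrow> bool"
  for G1 G2 H1 \<phi> where
  mult1: "\<lbrakk>x \<in> carrier G1; y \<in> carrier G1\<rbrakk>
      \<Longrightarrow> amalg_eq G1 G2 H1 \<phi> [Inl x, Inl y] [Inl (x \<otimes>\<^bsub>G1\<^esub> y)]"
| mult2: "\<lbrakk>x \<in> carrier G2; y \<in> carrier G2\<rbrakk>
      \<Longrightarrow> amalg_eq G1 G2 H1 \<phi> [Inr x, Inr y] [Inr (x \<otimes>\<^bsub>G2\<^esub> y)]"
| one1: "amalg_eq G1 G2 H1 \<phi> [Inl \<one>\<^bsub>G1\<^esub>] []"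
| one2: "amalg_eq G1 G2 H1 \<phi> [Inr \<one>\<^bsub>G2\<^esub>] []"
| amalgamate: "h \<in> H1 \<Longrightarrow> amalg_eq G1 G2 H1 \<phi> [Inl h] [Inr (\<phi> h)]"
| refl: "amalg_eq G1 G2 H1 \<phi> u u"
| sym: "amalg_eq G1 G2 H1 \<phi> u v \<Longrightarrow> amalg_eq G1 G2 H1 \<phi> v u"
| trans: "\<lbrakk>amalg_eq G1 G2 H1 \<phi> u v; amalg_eq G1 G2 H1 \<phi> v w\<rbrakk> \<Longrightarrow> amalg_eq G1 G2 H1 \<phi> u w"
| append: "\<lbrakk>amalg_eq G1 G2 H1 \<phi> u u'; amalg_eq G1 G2 H1 \<phi> v v'\<rbrakk>
      \<Longrightarrow> amalg_eq G1 G2 H1 \<phi> (u @ v) (u' @ v')"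

definition amalg_rel ::
    "('a, 'c) monoid_scheme \<Rightarrow> ('b, 'd) monoid_scheme \<Rightarrow> 'a set \<Rightarrow> ('a \<Rightarrow> 'b)
      \<Rightarrow> (('a + 'b) list \<times> ('a + 'b) list) set" where
  "amalg_rel G1 G2 H1 \<phi> =
     {(u, v). u \<in> amalg_words G1 G2 \<and> v \<in> amalg_words G1 G2 \<and> amalg_eq G1 G2 H1 \<phi> u v}"

definition amalgamated_product ::
    "('a, 'c) monoid_scheme \<Rightarrow> ('b, 'd) monoid_scheme \<Rightarrow> 'a set \<Rightarrow> ('a \<Rightarrow> 'b)
      \<Rightarrow> ('a + 'b) list set monoid" where
  "amalgamated_product G1 G2 H1 \<phi> =
     \<lparr>carrier = amalg_words G1 G2 // amalg_rel G1 G2 H1 \<phi>,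
      monoid.mult = (\<lambda>A B. \<Union>u\<in>A. \<Union>v\<in>B. amalg_rel G1 G2 H1 \<phi> `` {u @ v}),
      monoid.one = amalg_rel G1 G2 H1 \<phi> `` {[]}\<rparr>"

definition amalg_in1 ::
    "('a, 'c) monoid_scheme \<Rightarrow> ('b, 'd) monoid_scheme \<Rightarrow> 'a set \<Rightarrow> ('a \<Rightarrow> 'b)
      \<Rightarrow> 'a \<Rightarrow> ('a + 'b) list set" where
  "amalg_in1 G1 G2 H1 \<phi> x = amalg_rel G1 G2 H1 \<phi> `` {[Inl x]}"

definition amalg_in2 ::
    "('a, 'c) monoid_scheme \<Rightarrow> ('b, 'd) monoid_scheme \<Rightarrow> 'a set \<Rightarrow> ('a \<Rightarrow> 'b)
      \<Rightarrow> 'b \<Rightarrow> ('a + 'b) list set" where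
  "amalg_in2 G1 G2 H1 \<phi> y = amalg_rel G1 G2 H1 \<phi> `` {[Inr y]}"

text \<open>The images of \<open>G\<^sub>1\<close> and \<open>G\<^sub>2\<close>, which the notation \<open>G\<^sub>1 \<union> G\<^sub>2\<close> refers to inside the product.\<close>

definition amalg_factors ::
    "('a, 'c) monoid_scheme \<Rightarrow> ('b, 'd) monoid_scheme \<Rightarrow> 'a set \<Rightarrow> ('a \<Rightarrow> 'b)
      \<Rightarrow> ('a + 'b) list set set" where
  "amalg_factors G1 G2 H1 \<phi> =
     amalg_in1 G1 G2 H1 \<phi> ` carrier G1 \<union> amalg_in2 G1 G2 H1 \<phi> ` carrier G2"

subsection \<open>Basic properties of the amalgamated free product\<close>

lemma amalg_equiv: "equiv (amalg_words G1 G2) (amalg_rel G1 G2 H1 \<phi>)"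
proof (rule equivI)
  show "amalg_rel G1 G2 H1 \<phi> \<subseteq> amalg_words G1 G2 \<times> amalg_words G1 G2"
    by (auto simp: amalg_rel_def)
  show "refl_on (amalg_words G1 G2) (amalg_rel G1 G2 H1 \<phi>)"
    by (auto simp: amalg_rel_def refl_on_def amalg_eq.refl)
  show "sym (amalg_rel G1 G2 H1 \<phi>)"
    by (auto simp: amalg_rel_def sym_def dest: amalg_eq.sym)
  show "trans (amalg_rel G1 G2 H1 \<phi>)"
    by (rule transI) (simp add: amalg_rel_def, metis amalg_eq.trans)
qed

lemma amalg_words_append:
  "u @ v \<in> amalg_words G1 G2 \<longleftrightarrow> u \<in> amalg_words G1 G2 \<and> v \<in> amalg_words G1 G2"
  by (auto simp: amalg_words_def)

lemma amalg_class_eq: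
  assumes "u \<in> amalg_words G1 G2" "v \<in> amalg_words G1 G2"
  shows "amalg_rel G1 G2 H1 \<phi> `` {u} = amalg_rel G1 G2 H1 \<phi> `` {v} \<longleftrightarrow> amalg_eq G1 G2 H1 \<phi> u v"
  using eq_equiv_class_iff[OF amalg_equiv assms] assms by (auto simp: amalg_rel_def)

lemma amalg_mult_class:
  assumes "u \<in> amalg_words G1 G2" "v \<in> amalg_words G1 G2"
  shows "amalg_rel G1 G2 H1 \<phi> `` {u} \<otimes>\<^bsub>amalgamated_product G1 G2 H1 \<phi>\<^esub> amalg_rel G1 G2 H1 \<phi> `` {v}
    = amalg_rel G1 G2 H1 \<phi> `` {u @ v}"
proof -
  let ?R = "amalg_rel G1 G2 H1 \<phi>"
  have eq: "?R `` {u' @ v'} = ?R `` {u @ v}" if "u' \<in> ?R `` {u}" "v' \<in> ?R `` {v}" for u' v'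
  proof -
    have "u' @ v' \<in> amalg_words G1 G2" "u @ v \<in> amalg_words G1 G2"
      using that assms by (simp_all add: amalg_rel_def amalg_words_append)
    moreover have "amalg_eq G1 G2 H1 \<phi> (u' @ v') (u @ v)"
      using that by (simp add: amalg_rel_def amalg_eq.append amalg_eq.sym)
    ultimately show ?thesis by (simp add: amalg_class_eq)
  qed
  have "u \<in> ?R `` {u}" "v \<in> ?R `` {v}"
    using assms by (simp_all add: amalg_rel_def amalg_eq.refl)
  then have nonempty: "?R `` {u} \<noteq> {}" "?R `` {v} \<noteq> {}"
    by (metis empty_iff)+
  have "(\<Union>u'\<in>?R `` {u}. \<Union>v'\<in>?R `` {v}. ?R `` {u' @ v'})
      = (\<Union>u'\<in>?R `` {u}. \<Union>v'\<in>?R `` {v}. ?R `` {u @ v})"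
    by (intro SUP_cong HOL.refl eq)
  also have "\<dots> = ?R `` {u @ v}"
    by (simp only: UN_constant nonempty if_False)
  finally show ?thesis
    by (simp only: amalgamated_product_def monoid.simps partial_object.simps)
qed

lemma amalg_class_carrier:
  "u \<in> amalg_words G1 G2
    \<Longrightarrow> amalg_rel G1 G2 H1 \<phi> `` {u} \<in> carrier (amalgamated_product G1 G2 H1 \<phi>)"
  by (simp add: amalgamated_product_def quotientI)

lemma amalg_carrierE:
  assumes "A \<in> carrier (amalgamated_product G1 G2 H1 \<phi>)"
  obtains u where "u \<in> amalg_words G1 G2" "A = amalg_rel G1 G2 H1 \<phi> `` {u}"
  using assms by (auto simp: amalgamated_product_def elim: quotientE)

lemma amalg_one: "\<one>\<^bsub>amalgamated_product G1 G2 H1 \<phi>\<^esub> = amalg_rel G1 G2 H1 \<phi> `` {[]}"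
  by (simp add: amalgamated_product_def)

lemma amalg_left_inverse:
  assumes "group G1" "group G2" "u \<in> amalg_words G1 G2"
  shows "\<exists>v \<in> amalg_words G1 G2. amalg_eq G1 G2 H1 \<phi> (v @ u) []"
  using assms(3)
proof (induction u)
  case Nil
  then show ?case by (intro bexI[of _ "[]"]) (simp_all add: amalg_words_def amalg_eq.refl)
next
  case (Cons s u)
  then have s: "s \<in> Sum_Type.Plus (carrier G1) (carrier G2)" and u: "u \<in> amalg_words G1 G2"
    by (auto simp: amalg_words_def)
  from Cons.IH[OF u] obtain v
    where v: "v \<in> amalg_words G1 G2" "amalg_eq G1 G2 H1 \<phi> (v @ u) []" by blast
  have "\<exists>t \<in> Sum_Type.Plus (carrier G1) (carrier G2). amalg_eq G1 G2 H1 \<phi> [t, s] []"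
  proof (cases s)
    case (Inl x)
    then have x: "x \<in> carrier G1" using s by auto
    have "amalg_eq G1 G2 H1 \<phi> [Inl (inv\<^bsub>G1\<^esub> x), Inl x] [Inl \<one>\<^bsub>G1\<^esub>]"
      using amalg_eq.mult1[of "inv\<^bsub>G1\<^esub> x" G1 x G2 H1 \<phi>] x assms(1)
      by (simp add: group.l_inv group.inv_closed)
    then show ?thesis
      using Inl x assms(1) by (meson InlI amalg_eq.trans amalg_eq.one1 group.inv_closed)
  next
    case (Inr x)
    then have x: "x \<in> carrier G2" using s by auto
    have "amalg_eq G1 G2 H1 \<phi> [Inr (inv\<^bsub>G2\<^esub> x), Inr x] [Inr \<one>\<^bsub>G2\<^esub>]"
      using amalg_eq.mult2[of "inv\<^bsub>G2\<^esub> x" G2 x G1 H1 \<phi>] x assms(2)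
      by (simp add: group.l_inv group.inv_closed)
    then show ?thesis
      using Inr x assms(2) by (meson InrI amalg_eq.trans amalg_eq.one2 group.inv_closed)
  qed
  then obtain t
    where t: "t \<in> Sum_Type.Plus (carrier G1) (carrier G2)" "amalg_eq G1 G2 H1 \<phi> [t, s] []" by blast
  have "amalg_eq G1 G2 H1 \<phi> (v @ [t, s] @ u) (v @ [] @ u)"
    by (intro amalg_eq.append amalg_eq.refl t)
  then have "amalg_eq G1 G2 H1 \<phi> ((v @ [t]) @ s # u) []"
    using amalg_eq.trans[OF _ v(2)] by simp
  moreover have "v @ [t] \<in> amalg_words G1 G2"
    using v t by (auto simp: amalg_words_def)
  ultimately show ?case by blast
qed

lemma group_amalgamated_product:
  assumes "group G1" "group G2"
  shows "group (amalgamated_product G1 G2 H1 \<phi>)"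
proof (rule groupI)
  have nil: "[] \<in> amalg_words G1 G2" by (simp add: amalg_words_def)
  show "\<one>\<^bsub>amalgamated_product G1 G2 H1 \<phi>\<^esub> \<in> carrier (amalgamated_product G1 G2 H1 \<phi>)"
    by (simp add: amalg_one amalg_class_carrier nil)
  fix A assume "A \<in> carrier (amalgamated_product G1 G2 H1 \<phi>)"
  then obtain u where u: "u \<in> amalg_words G1 G2" "A = amalg_rel G1 G2 H1 \<phi> `` {u}"
    by (rule amalg_carrierE)
  show "\<one>\<^bsub>amalgamated_product G1 G2 H1 \<phi>\<^esub> \<otimes>\<^bsub>amalgamated_product G1 G2 H1 \<phi>\<^esub> A = A"
    by (simp add: amalg_one u amalg_mult_class nil)
  obtain v where v: "v \<in> amalg_words G1 G2" "amalg_eq G1 G2 H1 \<phi> (v @ u) []"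
    using amalg_left_inverse[OF assms u(1)] by blast
  have "amalg_rel G1 G2 H1 \<phi> `` {v} \<otimes>\<^bsub>amalgamated_product G1 G2 H1 \<phi>\<^esub> A
      = \<one>\<^bsub>amalgamated_product G1 G2 H1 \<phi>\<^esub>"
    using v u nil by (simp add: amalg_one amalg_mult_class amalg_class_eq amalg_words_append)
  then show "\<exists>B\<in>carrier (amalgamated_product G1 G2 H1 \<phi>).
      B \<otimes>\<^bsub>amalgamated_product G1 G2 H1 \<phi>\<^esub> A = \<one>\<^bsub>amalgamated_product G1 G2 H1 \<phi>\<^esub>"
    using v(1) amalg_class_carrier by blast
  fix B assume "B \<in> carrier (amalgamated_product G1 G2 H1 \<phi>)"
  then obtain w where w: "w \<in> amalg_words G1 G2" "B = amalg_rel G1 G2 H1 \<phi> `` {w}"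
    by (rule amalg_carrierE)
  show "A \<otimes>\<^bsub>amalgamated_product G1 G2 H1 \<phi>\<^esub> B \<in> carrier (amalgamated_product G1 G2 H1 \<phi>)"
    using u w by (simp add: amalg_mult_class amalg_class_carrier amalg_words_append)
  fix C assume "C \<in> carrier (amalgamated_product G1 G2 H1 \<phi>)"
  then obtain z where z: "z \<in> amalg_words G1 G2" "C = amalg_rel G1 G2 H1 \<phi> `` {z}"
    by (rule amalg_carrierE)
  show "A \<otimes>\<^bsub>amalgamated_product G1 G2 H1 \<phi>\<^esub> B \<otimes>\<^bsub>amalgamated_product G1 G2 H1 \<phi>\<^esub> C
      = A \<otimes>\<^bsub>amalgamated_product G1 G2 H1 \<phi>\<^esub> (B \<otimes>\<^bsub>amalgamated_product G1 G2 H1 \<phi>\<^esub> C)"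
    using u w z by (simp add: amalg_mult_class amalg_words_append)
qed

lemma amalg_in1_hom:
  assumes "group G1"
  shows "amalg_in1 G1 G2 H1 \<phi> \<in> hom G1 (amalgamated_product G1 G2 H1 \<phi>)"
proof (rule homI)
  fix x y assume xy: "x \<in> carrier G1" "y \<in> carrier G1"
  have "x \<otimes>\<^bsub>G1\<^esub> y \<in> carrier G1"
    using assms xy by (simp add: group.is_monoid monoid.m_closed)
  then have "amalg_rel G1 G2 H1 \<phi> `` {[Inl (x \<otimes>\<^bsub>G1\<^esub> y)]} = amalg_rel G1 G2 H1 \<phi> `` {[Inl x, Inl y]}"
    using xy
    by (subst amalg_class_eq) (simp_all add: amalg_words_def amalg_eq.sym[OF amalg_eq.mult1] InlI InrI)
  then show "amalg_in1 G1 G2 H1 \<phi> (x \<otimes>\<^bsub>G1\<^esub> y)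
      = amalg_in1 G1 G2 H1 \<phi> x \<otimes>\<^bsub>amalgamated_product G1 G2 H1 \<phi>\<^esub> amalg_in1 G1 G2 H1 \<phi> y"
    using xy by (simp add: amalg_in1_def amalg_mult_class amalg_words_def InlI)
qed (simp add: amalg_in1_def amalg_class_carrier amalg_words_def InlI)

lemma amalg_in2_hom:
  assumes "group G2"
  shows "amalg_in2 G1 G2 H1 \<phi> \<in> hom G2 (amalgamated_product G1 G2 H1 \<phi>)"
proof (rule homI)
  fix x y assume xy: "x \<in> carrier G2" "y \<in> carrier G2"
  have "x \<otimes>\<^bsub>G2\<^esub> y \<in> carrier G2"
    using assms xy by (simp add: group.is_monoid monoid.m_closed)
  then have "amalg_rel G1 G2 H1 \<phi> `` {[Inr (x \<otimes>\<^bsub>G2\<^esub> y)]} = amalg_rel G1 G2 H1 \<phi> `` {[Inr x, Inr y]}"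
    using xy
    by (subst amalg_class_eq) (simp_all add: amalg_words_def amalg_eq.sym[OF amalg_eq.mult2] InlI InrI)
  then show "amalg_in2 G1 G2 H1 \<phi> (x \<otimes>\<^bsub>G2\<^esub> y)
      = amalg_in2 G1 G2 H1 \<phi> x \<otimes>\<^bsub>amalgamated_product G1 G2 H1 \<phi>\<^esub> amalg_in2 G1 G2 H1 \<phi> y"
    using xy by (simp add: amalg_in2_def amalg_mult_class amalg_words_def InrI)
qed (simp add: amalg_in2_def amalg_class_carrier amalg_words_def InrI)

lemma amalg_in_identified:
  assumes "h \<in> H1" "H1 \<subseteq> carrier G1" "\<phi> ` H1 \<subseteq> carrier G2"
  shows "amalg_in1 G1 G2 H1 \<phi> h = amalg_in2 G1 G2 H1 \<phi> (\<phi> h)"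
  unfolding amalg_in1_def amalg_in2_def
  using assms by (subst amalg_class_eq) (auto simp: amalg_words_def amalg_eq.amalgamate)

lemma amalg_generate:
  assumes "group G1" "group G2"
  shows "generate (amalgamated_product G1 G2 H1 \<phi>) (amalg_factors G1 G2 H1 \<phi>)
    = carrier (amalgamated_product G1 G2 H1 \<phi>)"
proof
  have "amalg_factors G1 G2 H1 \<phi> \<subseteq> carrier (amalgamated_product G1 G2 H1 \<phi>)"
    by (auto simp: amalg_factors_def hom_in_carrier[OF amalg_in1_hom[OF assms(1)]]
        hom_in_carrier[OF amalg_in2_hom[OF assms(2)]])
  then show "generate (amalgamated_product G1 G2 H1 \<phi>) (amalg_factors G1 G2 H1 \<phi>)
      \<subseteq> carrier (amalgamated_product G1 G2 H1 \<phi>)"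
    by (rule group.generate_incl[OF group_amalgamated_product[OF assms]])
  have "amalg_rel G1 G2 H1 \<phi> `` {u}
      \<in> generate (amalgamated_product G1 G2 H1 \<phi>) (amalg_factors G1 G2 H1 \<phi>)"
    if "u \<in> amalg_words G1 G2" for u
    using that
  proof (induction u)
    case Nil
    then show ?case using generate.one amalg_one by metis
  next
    case (Cons s u)
    then have s: "[s] \<in> amalg_words G1 G2" and u: "u \<in> amalg_words G1 G2"
      by (auto simp: amalg_words_def)
    have "amalg_rel G1 G2 H1 \<phi> `` {[s]} \<in> amalg_factors G1 G2 H1 \<phi>"
      using s by (cases s) (auto simp: amalg_words_def amalg_factors_def amalg_in1_def amalg_in2_def)
    from generate.eng[OF generate.incl[OF this] Cons.IH[OF u]] show ?case
      by (simp add: amalg_mult_class[OF s u])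
  qed
  then show "carrier (amalgamated_product G1 G2 H1 \<phi>)
      \<subseteq> generate (amalgamated_product G1 G2 H1 \<phi>) (amalg_factors G1 G2 H1 \<phi>)"
    by (auto elim: amalg_carrierE)
qed

text \<open>Existence part of the universal property; uniqueness is immediate from \<open>amalg_generate\<close>.\<close>

lemma amalg_universal:
  assumes "group G1" "group G2" "group K"
    and f1: "f1 \<in> hom G1 K" and f2: "f2 \<in> hom G2 K"
    and "\<And>h. h \<in> H1 \<Longrightarrow> f1 h = f2 (\<phi> h)" "H1 \<subseteq> carrier G1" "\<phi> ` H1 \<subseteq> carrier G2"
  shows "\<exists>f \<in> hom (amalgamated_product G1 G2 H1 \<phi>) K.
    (\<forall>x \<in> carrier G1. f (amalg_in1 G1 G2 H1 \<phi> x) = f1 x) \<and>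
    (\<forall>y \<in> carrier G2. f (amalg_in2 G1 G2 H1 \<phi> y) = f2 y)"
proof -
  interpret K: group K by fact
  \<comment> \<open>\<open>amalg_eq\<close> also relates words containing junk letters, which are therefore sent to the identity\<close>
  define g where "g s = (if s \<in> Sum_Type.Plus (carrier G1) (carrier G2) then case_sum f1 f2 s else \<one>\<^bsub>K\<^esub>)" for s
  have g_closed: "g s \<in> carrier K" for s
    using f1 f2 by (auto simp: g_def hom_def split: sum.splits)
  define ev where "ev w = foldr (\<lambda>s a. g s \<otimes>\<^bsub>K\<^esub> a) w \<one>\<^bsub>K\<^esub>" for w
  have ev_simps: "ev [] = \<one>\<^bsub>K\<^esub>" "ev (s # w) = g s \<otimes>\<^bsub>K\<^esub> ev w" for s w
    by (simp_all add: ev_def)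
  have ev_closed: "ev w \<in> carrier K" for w
    by (induction w) (auto simp: ev_simps g_closed)
  have ev_append: "ev (u @ v) = ev u \<otimes>\<^bsub>K\<^esub> ev v" for u v
    by (induction u) (auto simp: ev_simps g_closed ev_closed K.m_assoc)
  have g_Inl: "g (Inl x) = f1 x" if "x \<in> carrier G1" for x
    using that by (simp add: g_def InlI)
  have g_Inr: "g (Inr y) = f2 y" if "y \<in> carrier G2" for y
    using that by (simp add: g_def InrI)
  have ev_single: "ev [s] = g s" for s
    by (simp add: ev_simps g_closed)
  have ev_eq: "amalg_eq G1 G2 H1 \<phi> u v \<Longrightarrow> ev u = ev v" for u v
  proof (induction rule: amalg_eq.induct)
    case (mult1 x y)
    then have "x \<otimes>\<^bsub>G1\<^esub> y \<in> carrier G1"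
      using assms(1) by (simp add: group.is_monoid monoid.m_closed)
    then show ?case
      using mult1 by (simp add: ev_simps g_Inl hom_mult[OF f1] hom_in_carrier[OF f1])
  next
    case (mult2 x y)
    then have "x \<otimes>\<^bsub>G2\<^esub> y \<in> carrier G2"
      using assms(2) by (simp add: group.is_monoid monoid.m_closed)
    then show ?case
      using mult2 by (simp add: ev_simps g_Inr hom_mult[OF f2] hom_in_carrier[OF f2])
  next
    case one1
    have "\<one>\<^bsub>G1\<^esub> \<in> carrier G1" using assms(1) by (simp add: group.is_monoid monoid.one_closed)
    then show ?case
      using hom_one[OF f1 assms(1,3)] by (simp add: ev_simps g_Inl)
  next
    case one2
    have "\<one>\<^bsub>G2\<^esub> \<in> carrier G2" using assms(2) by (simp add: group.is_monoid monoid.one_closed)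
    then show ?case
      using hom_one[OF f2 assms(2,3)] by (simp add: ev_simps g_Inr)
  next
    case (amalgamate h)
    then have "h \<in> carrier G1" "\<phi> h \<in> carrier G2"
      using assms(7,8) by blast+
    then show ?case
      using assms(6)[OF amalgamate] by (simp add: ev_single g_Inl g_Inr)
  qed (simp_all add: ev_append)
  define f where "f A = ev (SOME u. u \<in> A)" for A
  have f_class: "f (amalg_rel G1 G2 H1 \<phi> `` {u}) = ev u" if "u \<in> amalg_words G1 G2" for u
  proof -
    have "u \<in> amalg_rel G1 G2 H1 \<phi> `` {u}"
      using that by (simp add: amalg_rel_def amalg_eq.refl)
    then have "(SOME v. v \<in> amalg_rel G1 G2 H1 \<phi> `` {u}) \<in> amalg_rel G1 G2 H1 \<phi> `` {u}"
      by (rule someI)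
    then have "amalg_eq G1 G2 H1 \<phi> u (SOME v. v \<in> amalg_rel G1 G2 H1 \<phi> `` {u})"
      unfolding amalg_rel_def Image_singleton_iff mem_Collect_eq prod.case by blast
    then show ?thesis
      by (simp add: f_def ev_eq)
  qed
  have "f \<in> hom (amalgamated_product G1 G2 H1 \<phi>) K"
  proof (rule homI)
    fix A assume "A \<in> carrier (amalgamated_product G1 G2 H1 \<phi>)"
    then obtain u where u: "u \<in> amalg_words G1 G2" "A = amalg_rel G1 G2 H1 \<phi> `` {u}"
      by (rule amalg_carrierE)
    show "f A \<in> carrier K"
      by (simp add: u f_class ev_closed)
    fix B assume "B \<in> carrier (amalgamated_product G1 G2 H1 \<phi>)"
    then obtain w where w: "w \<in> amalg_words G1 G2" "B = amalg_rel G1 G2 H1 \<phi> `` {w}"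
      by (rule amalg_carrierE)
    show "f (A \<otimes>\<^bsub>amalgamated_product G1 G2 H1 \<phi>\<^esub> B) = f A \<otimes>\<^bsub>K\<^esub> f B"
      using u w by (simp add: f_class amalg_mult_class amalg_words_append ev_append)
  qed
  moreover have "f (amalg_in1 G1 G2 H1 \<phi> x) = f1 x" if "x \<in> carrier G1" for x
    using that by (simp add: amalg_in1_def f_class amalg_words_def ev_single g_Inl InlI)
  moreover have "f (amalg_in2 G1 G2 H1 \<phi> y) = f2 y" if "y \<in> carrier G2" for y
    using that by (simp add: amalg_in2_def f_class amalg_words_def ev_single g_Inr InrI)
  ultimately show ?thesis by blast
qed

subsection \<open>Almost palindromes and almost palindromic width\<close>

text \<open>
  The alphabet \<open>S\<^sup>\<plusminus>\<^sup>1\<close> is read as the subset \<open>S \<union> S\<inverse>\<close> of the group, so two letters are inverse to each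
  other when they are so in the group. With formal inverses instead (words over \<open>S \<times> {1, -1}\<close>, freely
  reduced), there are at least as many reduced palindromes, hence the width can only be smaller.
\<close>

definition sym_alphabet :: "('a, 'b) monoid_scheme \<Rightarrow> 'a set \<Rightarrow> 'a set" where
  "sym_alphabet G S = S \<union> (\<lambda>x. inv\<^bsub>G\<^esub> x) ` S"

definition reduced_word :: "('a, 'b) monoid_scheme \<Rightarrow> 'a list \<Rightarrow> bool" where
  "reduced_word G w \<longleftrightarrow> successively (\<lambda>x y. y \<noteq> inv\<^bsub>G\<^esub> x) w"

definition list_product :: "('a, 'b) monoid_scheme \<Rightarrow> 'a list \<Rightarrow> 'a" where
  "list_product G w = foldr (\<otimes>\<^bsub>G\<^esub>) w \<one>\<^bsub>G\<^esub>"

definition palindrome_word :: "('a, 'b) monoid_scheme \<Rightarrow> 'a set \<Rightarrow> 'a list \<Rightarrow> bool" where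
  "palindrome_word G S w \<longleftrightarrow> w \<in> lists (sym_alphabet G S) \<and> reduced_word G w \<and> rev w = w"

definition almost_palindromes :: "('a, 'b) monoid_scheme \<Rightarrow> 'a set \<Rightarrow> nat \<Rightarrow> 'a set" where
  "almost_palindromes G S m =
     {g \<in> carrier G. \<exists>w \<in> lists (sym_alphabet G S). list_product G w = g \<and>
        (\<exists>p. palindrome_word G S p \<and> length p = length w \<and>
             card {i. i < length w \<and> w ! i \<noteq> p ! i} \<le> m)}"

text \<open>The value is \<open>\<infinity>\<close> if \<open>g\<close> is not a product of \<open>m\<close>-almost palindromes.\<close>

definition almost_palindromic_length ::
    "('a, 'b) monoid_scheme \<Rightarrow> 'a set \<Rightarrow> nat \<Rightarrow> 'a \<Rightarrow> enat" where
  "almost_palindromic_length G S m g =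
     Inf {enat (length ps) | ps. ps \<in> lists (almost_palindromes G S m) \<and> list_product G ps = g}"

definition almost_palindromic_width ::
    "('a, 'b) monoid_scheme \<Rightarrow> 'a set \<Rightarrow> nat \<Rightarrow> enat" where
  "almost_palindromic_width G S m = (SUP g \<in> carrier G. almost_palindromic_length G S m g)"

end

theory Submission
  imports Defs
begin

text \<open>
  Write \<open>N\<close> for the image of \<open>H\<close>. Having index two in both factors, it is normal in the
  product, and \<open>N\<close>-cosets are represented by alternating products of two letters \<open>a\<close> and \<open>b\<close>.
  For every \<open>n \<in> N\<close> and every letter \<open>x\<close>, \<open>n x d x = x n' d x\<close> for some \<open>n' \<in> N\<close>, so a factor
  from \<open>N\<close> moves to the centre of an alternating product of odd length, where it is absorbed by the
  central letter. Hence all elements of odd coset length are palindromes, and those of even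
  length are palindromes times a letter, which gives width at most two for every \<open>m\<close>.
\<close>

subsection \<open>Palindromes\<close>

lemma (in monoid) list_product_closed:
  "w \<in> lists (carrier G) \<Longrightarrow> list_product G w \<in> carrier G"
  by (induction w) (auto simp: list_product_def)

lemma (in monoid) list_product_append:
  "\<lbrakk>u \<in> lists (carrier G); v \<in> lists (carrier G)\<rbrakk>
    \<Longrightarrow> list_product G (u @ v) = list_product G u \<otimes> list_product G v"
  using list_product_closed
  by (induction u) (auto simp: list_product_def m_assoc)

lemma (in group) sym_alphabet_carrier: "S \<subseteq> carrier G \<Longrightarrow> sym_alphabet G S \<subseteq> carrier G"
  by (auto simp: sym_alphabet_def)

text \<open>Comparing the word with itself gives zero changed letters, which is within every bound
  \<open>m\<close>.\<close>

lemma (in group) palindrome_almost_palindrome: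
  assumes "palindrome_word G S p" "S \<subseteq> carrier G"
  shows "list_product G p \<in> almost_palindromes G S m"
proof -
  have "p \<in> lists (sym_alphabet G S)"
    using assms(1) by (simp add: palindrome_word_def)
  moreover from this have "list_product G p \<in> carrier G"
    using sym_alphabet_carrier[OF assms(2)] by (intro list_product_closed) auto
  ultimately show ?thesis
    unfolding almost_palindromes_def using assms(1) by fastforce
qed

lemma palindrome_word_single:
  "x \<in> S \<Longrightarrow> palindrome_word G S [x]"
  by (simp add: palindrome_word_def sym_alphabet_def reduced_word_def)

text \<open>Reducedness can only fail at the two new junctions. As \<open>p\<close> is a palindrome,
  its last letter equals its first, so the single condition on \<open>x\<close> and
  \<open>hd p\<close> settles both.\<close>

lemma (in group) palindrome_word_surround:
  assumes "palindrome_word G S p" "p \<noteq> []" "x \<in> S" "S \<subseteq> carrier G" "x \<otimes> hd p \<noteq> \<one>"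
  shows "palindrome_word G S (x # p @ [x])"
proof -
  have p: "p \<in> lists (sym_alphabet G S)" "rev p = p" "reduced_word G p"
    using assms(1) by (simp_all add: palindrome_word_def)
  have carr: "x \<in> carrier G" "hd p \<in> carrier G"
    using p(1) assms(2-4) sym_alphabet_carrier[OF assms(4)] by (cases p; auto)+
  have "last p = hd p"
    using p(2) assms(2) by (metis hd_rev)
  moreover have "hd p \<noteq> inv x" "x \<noteq> inv (hd p)"
    using assms(5) carr by auto
  ultimately have "reduced_word G (x # p @ [x])"
    using p(3) assms(2)
    by (auto simp: reduced_word_def successively_Cons successively_append_iff)
  then show ?thesis
    using p assms(3) by (auto simp: palindrome_word_def sym_alphabet_def)
qed

lemma almost_palindromic_width_le:
  assumes "\<And>g. g \<in> carrier G \<Longrightarrow>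
    \<exists>ps \<in> lists (almost_palindromes G S m). length ps \<le> k \<and> list_product G ps = g"
  shows "almost_palindromic_width G S m \<le> enat k"
  unfolding almost_palindromic_width_def
proof (rule SUP_least)
  fix g assume "g \<in> carrier G"
  from assms[OF this] obtain ps where "ps \<in> lists (almost_palindromes G S m)"
    "length ps \<le> k" "list_product G ps = g" by blast
  then have "almost_palindromic_length G S m g \<le> enat (length ps)"
    unfolding almost_palindromic_length_def by (intro Inf_lower) blast
  also have "\<dots> \<le> enat k"
    using \<open>length ps \<le> k\<close> by simp
  finally show "almost_palindromic_length G S m g \<le> enat k" .
qed

subsection \<open>Alternating products\<close>

text \<open>The product \<open>x y x ...\<close> with \<open>n\<close> factors. Modulo a normal
  subgroup containing both squares, the alternating products starting with \<open>x\<close> or with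
  \<open>y\<close> exhaust the subgroup generated by the two classes.\<close>

fun alternating_product :: "('a, 'b) monoid_scheme \<Rightarrow> nat \<Rightarrow> 'a \<Rightarrow> 'a \<Rightarrow> 'a" where
  "alternating_product G 0 x y = \<one>\<^bsub>G\<^esub>"
| "alternating_product G (Suc n) x y = x \<otimes>\<^bsub>G\<^esub> alternating_product G n y x"

lemma (in monoid) alternating_product_closed [simp]:
  "\<lbrakk>x \<in> carrier G; y \<in> carrier G\<rbrakk> \<Longrightarrow> alternating_product G n x y \<in> carrier G"
  by (induction n arbitrary: x y) auto

text \<open>The recursion exposes the left end only; palindromes grow at both ends, so the right end
  has to be accessible too.\<close>

lemma (in monoid) alternating_product_snoc:
  "\<lbrakk>x \<in> carrier G; y \<in> carrier G\<rbrakk> \<Longrightarrow>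
    alternating_product G (Suc n) x y = alternating_product G n x y \<otimes> (if even n then x else y)"
proof (induction n arbitrary: x y)
  case (Suc n)
  have "alternating_product G (Suc (Suc n)) x y
      = x \<otimes> (alternating_product G n y x \<otimes> (if even n then y else x))"
    using Suc.IH[OF Suc.prems(2,1)] by simp
  then show ?case
    using Suc.prems by (auto simp: m_assoc)
qed auto

context group
begin

lemma normal_conj:
  assumes "N \<lhd> G" "n \<in> N" "x \<in> carrier G"
  obtains n' where "n' \<in> N" "x \<otimes> n = n' \<otimes> x"
proof
  have "n \<in> carrier G"
    using subgroup.mem_carrier[OF normal_imp_subgroup[OF assms(1)] assms(2)] .
  then show "x \<otimes> n = (x \<otimes> n \<otimes> inv x) \<otimes> x"
    using assms(3) by (simp add: m_assoc)
  show "x \<otimes> n \<otimes> inv x \<in> N"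
    using assms by (simp add: normal.inv_op_closed2)
qed

lemma normal_conj':
  assumes "N \<lhd> G" "n \<in> N" "x \<in> carrier G"
  obtains n' where "n' \<in> N" "n \<otimes> x = x \<otimes> n'"
proof
  have "n \<in> carrier G"
    using subgroup.mem_carrier[OF normal_imp_subgroup[OF assms(1)] assms(2)] .
  then show "n \<otimes> x = x \<otimes> (inv x \<otimes> n \<otimes> x)"
    using assms(3) by (simp add: m_assoc[symmetric])
  show "inv x \<otimes> n \<otimes> x \<in> N"
    using assms by (simp add: normal.inv_op_closed1)
qed

text \<open>The palindrome is built from its centre outwards: \<open>n\<close> is pushed past the
  outer \<open>x\<close>, the induction hypothesis with \<open>x\<close> and \<open>y\<close>
  swapped absorbs it in the core, and \<open>x\<close> is put on both sides. The clause on
  \<open>hd p\<close> is carried along to show that the new outer letter does not cancel.\<close>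

lemma odd_alternating_product_palindrome:
  assumes N: "N \<lhd> G" and S: "S \<subseteq> carrier G"
  shows "\<lbrakk>x \<in> S; y \<in> S; N #> x \<subseteq> S; N #> y \<subseteq> S; x \<otimes> y \<notin> N; y \<otimes> x \<notin> N; n \<in> N\<rbrakk> \<Longrightarrow>
    \<exists>p. palindrome_word G S p \<and> p \<noteq> [] \<and> hd p \<in> N #> x \<and>
      list_product G p = n \<otimes> alternating_product G (Suc (2 * k)) x y"
proof (induction k arbitrary: x y n)
  case 0
  then have "x \<in> carrier G" "n \<otimes> x \<in> N #> x" "n \<in> carrier G"
    using S N by (auto simp: r_coset_def dest!: normal_imp_subgroup subgroup.mem_carrier)
  then show ?case
    using 0 by (intro exI[of _ "[n \<otimes> x]"]) (auto intro: palindrome_word_single simp: list_product_def)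
next
  case (Suc k)
  interpret N: normal N G by fact
  let ?d = "alternating_product G (Suc (2 * k)) y x"
  have carr: "x \<in> carrier G" "y \<in> carrier G" "n \<in> carrier G"
    using Suc.prems S by auto
  obtain n' where n': "n' \<in> N" "n \<otimes> x = x \<otimes> n'"
    using normal_conj'[OF N Suc.prems(7) carr(1)] .
  obtain p where p: "palindrome_word G S p" "p \<noteq> []" "hd p \<in> N #> y"
      "list_product G p = n' \<otimes> ?d"
    using Suc.IH[of y x n'] Suc.prems n' by blast
  \<comment> \<open>The product of \<open>x\<close> with an element of \<open>N y\<close> lies in
    the coset \<open>N (x y)\<close>, so it can be trivial only if \<open>x y\<close> is in
    \<open>N\<close>.\<close>
  have "x \<otimes> hd p \<noteq> \<one>"
  proof
    assume "x \<otimes> hd p = \<one>"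
    moreover obtain l where l: "l \<in> N" "hd p = l \<otimes> y"
      using p(3) by (auto simp: r_coset_def)
    moreover obtain l' where l': "l' \<in> N" "x \<otimes> l = l' \<otimes> x"
      using normal_conj[OF N l(1) carr(1)] .
    ultimately have "l' \<otimes> (x \<otimes> y) = \<one>"
      using carr by (metis N.mem_carrier m_assoc)
    then have "x \<otimes> y = inv l'"
      using carr l' by (metis N.mem_carrier inv_equality inv_inv m_closed)
    then show False
      using Suc.prems(5) l'(1) by simp
  qed
  then have "palindrome_word G S (x # p @ [x])"
    using p Suc.prems(1) S by (intro palindrome_word_surround)
  moreover have "list_product G (x # p @ [x]) = n \<otimes> alternating_product G (Suc (2 * Suc k)) x y"
  proof -
    have "p \<in> lists (carrier G)"
      using p(1) sym_alphabet_carrier[OF S] by (auto simp: palindrome_word_def)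
    then have "list_product G (x # p @ [x]) = x \<otimes> (list_product G p \<otimes> x)"
      using carr list_product_append[of p "[x]"] by (simp add: list_product_def)
    \<comment> \<open>The factor hidden in the core comes out again through
      \<open>x n' = n x\<close>.\<close>
    also have "\<dots> = n \<otimes> (x \<otimes> (?d \<otimes> x))"
      using carr n' p(4) by (simp del: alternating_product.simps add: m_assoc[symmetric])
    \<comment> \<open>The odd product \<open>?d\<close> starts and ends with \<open>y\<close>, so
      appending \<open>x\<close> continues the alternation.\<close>
    also have "?d \<otimes> x = alternating_product G (Suc (Suc (2 * k))) y x"
      using alternating_product_snoc[OF carr(2,1), of "Suc (2 * k)"] by simp
    finally show ?thesis by simp
  qed
  moreover have "hd (x # p @ [x]) \<in> N #> x"
    using carr N.one_closed by (force simp: r_coset_def)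
  ultimately show ?case by blast
qed

text \<open>Normality collects the factors from \<open>N\<close> in front. Then \<open>x\<close>
  either prolongs the alternating product or meets a leading \<open>x\<close>, and their square
  joins the factor from \<open>N\<close>.\<close>

lemma normal_mult_alternating_product:
  assumes N: "N \<lhd> G" and x: "x \<in> carrier G" and y: "y \<in> carrier G" and xx: "x \<otimes> x \<in> N"
    and n: "n \<in> N" and m: "m \<in> N"
    and c: "(u, v) = (x, y) \<or> (u, v) = (y, x)"
  shows "\<exists>l \<in> N. \<exists>j u' v'. ((u', v') = (x, y) \<or> (u', v') = (y, x)) \<and>
    (n \<otimes> x) \<otimes> (m \<otimes> alternating_product G k u v) = l \<otimes> alternating_product G j u' v'"
proof -
  interpret N: normal N G by fact
  obtain m' where m': "m' \<in> N" "x \<otimes> m = m' \<otimes> x"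
    using normal_conj[OF N m x] .
  have carr: "n \<in> carrier G" "m \<in> carrier G" "m' \<in> carrier G" "u \<in> carrier G" "v \<in> carrier G"
    using n m m' c x y by auto
  have move: "(n \<otimes> x) \<otimes> (m \<otimes> z) = (n \<otimes> m') \<otimes> (x \<otimes> z)" if "z \<in> carrier G" for z
    using that carr x m'(2) by (metis m_assoc m_closed)
  show ?thesis
  \<comment> \<open>An empty product starts with neither letter, so for \<open>k = 0\<close> the
    letter \<open>x\<close> can be prefixed whatever the order of \<open>u\<close> and
    \<open>v\<close>.\<close>
  proof (cases "(u, v) = (y, x) \<or> k = 0")
    case True
    then have "x \<otimes> alternating_product G k u v = alternating_product G (Suc k) x y"
      using x y by auto
    then have "(n \<otimes> x) \<otimes> (m \<otimes> alternating_product G k u v)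
        = (n \<otimes> m') \<otimes> alternating_product G (Suc k) x y"
      using move carr by (metis alternating_product_closed)
    then show ?thesis using n m' by blast
  next
    case False
    then obtain j where j: "k = Suc j" "u = x" "v = y"
      using c by (cases k) auto
    have "(n \<otimes> x) \<otimes> (m \<otimes> alternating_product G k u v)
        = (n \<otimes> m' \<otimes> (x \<otimes> x)) \<otimes> alternating_product G j y x"
      using move[of "alternating_product G k u v"] carr x y by (simp add: j m_assoc)
    then show ?thesis using n m' xx by blast
  qed
qed

text \<open>The set \<open>E\<close> of all such elements contains the identity and is stable under
  left multiplication by generators, hence by the whole group.\<close>

lemma alternating_product_representative:
  assumes N: "N \<lhd> G" and a: "a \<in> carrier G" and b: "b \<in> carrier G"
    and aa: "a \<otimes> a \<in> N" and bb: "b \<otimes> b \<in> N"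
    and S: "S = N \<union> (N #> a) \<union> (N #> b)" and gen: "generate G S = carrier G"
    and inv_S: "\<And>s. s \<in> S \<Longrightarrow> inv s \<in> S"
    and g: "g \<in> carrier G"
  shows "\<exists>n \<in> N. \<exists>k x y. ((x, y) = (a, b) \<or> (x, y) = (b, a)) \<and> g = n \<otimes> alternating_product G k x y"
proof -
  interpret N: normal N G by fact
  define E where "E = {g. \<exists>n \<in> N. \<exists>k x y. ((x, y) = (a, b) \<or> (x, y) = (b, a))
    \<and> g = n \<otimes> alternating_product G k x y}"
  have E_carrier: "E \<subseteq> carrier G"
    using a b by (auto simp: E_def)
  have S_E: "s \<otimes> e \<in> E" if s: "s \<in> S" and "e \<in> E" for s e
  proof -
    obtain m k u v where m: "m \<in> N" and uv: "(u, v) = (a, b) \<or> (u, v) = (b, a)"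
        and e: "e = m \<otimes> alternating_product G k u v"
      using \<open>e \<in> E\<close> unfolding E_def by blast
    from s consider "s \<in> N" | n where "n \<in> N" "s = n \<otimes> a" | n where "n \<in> N" "s = n \<otimes> b"
      unfolding S r_coset_def by blast
    then show ?thesis
    proof cases
      case 1
      then have "s \<otimes> e = (s \<otimes> m) \<otimes> alternating_product G k u v"
        using m uv a b by (auto simp: e m_assoc)
      then show ?thesis
        unfolding E_def using 1 m uv by blast
    next
      case (2 n)
      then show ?thesis
        using normal_mult_alternating_product[OF N a b aa 2(1) m uv]
        unfolding E_def e by blast
    next
      case (3 n)
      have "(u, v) = (b, a) \<or> (u, v) = (a, b)"
        using uv by blast
      from normal_mult_alternating_product[OF N b a bb 3(1) m this] 3 show ?thesis
        unfolding E_def e by blast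
    qed
  qed
  have S_carrier: "S \<subseteq> carrier G"
    using generate.incl[of _ S G] gen by auto
  have "g \<in> generate G S"
    using g gen by simp
  then have "\<forall>e \<in> E. g \<otimes> e \<in> E"
  proof induction
    case one
    then show ?case using E_carrier by auto
  next
    case (eng h1 h2)
    then have "h1 \<in> carrier G" "h2 \<in> carrier G" using gen by auto
    then have "h1 \<otimes> h2 \<otimes> e = h1 \<otimes> (h2 \<otimes> e)" if "e \<in> E" for e
      using that E_carrier by (simp add: m_assoc subsetD)
    then show ?case
      using eng.IH by simp
  qed (use S_E inv_S in auto)
  moreover have "\<one> \<in> E"
    unfolding E_def by (force intro: bexI[of _ \<one>] exI[of _ 0])
  ultimately have "g \<in> E"
    using g by force
  then show ?thesis by (simp add: E_def)
qed

text \<open>The amalgam enters the width estimate only through these properties of \<open>N\<close>,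
  \<open>a\<close> and \<open>b\<close>.\<close>

lemma almost_palindromic_width_le_2:
  assumes N: "N \<lhd> G" and a: "a \<in> carrier G" and b: "b \<in> carrier G"
    and aa: "a \<otimes> a \<in> N" and bb: "b \<otimes> b \<in> N" and ab: "a \<otimes> b \<notin> N"
    and S: "S = N \<union> (N #> a) \<union> (N #> b)" and gen: "generate G S = carrier G"
    and inv_S: "\<And>s. s \<in> S \<Longrightarrow> inv s \<in> S"
  shows "almost_palindromic_width G S m \<le> enat 2"
proof (rule almost_palindromic_width_le)
  interpret N: normal N G by fact
  have S_carrier: "S \<subseteq> carrier G"
    using generate.incl[of _ S G] gen by auto
  have ba: "b \<otimes> a \<notin> N"
  proof
    assume "b \<otimes> a \<in> N"
    \<comment> \<open>Conjugation by \<open>a\<close> turns \<open>b a\<close> into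
      \<open>a b\<close>.\<close>
    then have "a \<otimes> (b \<otimes> a) \<otimes> inv a \<in> N"
      using a by (simp add: N.inv_op_closed2)
    then show False
      using ab a b by (simp add: m_assoc)
  qed
  have mem: "a \<in> S" "b \<in> S"
    using a b N.one_closed by (force simp: S r_coset_def)+
  fix g assume "g \<in> carrier G"
  then obtain n k x y where n: "n \<in> N" and xy: "(x, y) = (a, b) \<or> (x, y) = (b, a)"
      and g: "g = n \<otimes> alternating_product G k x y"
    using alternating_product_representative[OF N a b aa bb S gen inv_S] by blast
  have xyS: "x \<in> S" "y \<in> S" "N #> x \<subseteq> S" "N #> y \<subseteq> S" "x \<otimes> y \<notin> N" "y \<otimes> x \<notin> N"
    using xy mem ab ba by (auto simp: S)
  have carr: "n \<in> carrier G" "x \<in> carrier G" "y \<in> carrier G"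
    using n xyS S_carrier by auto
  note odd = odd_alternating_product_palindrome[OF N S_carrier xyS n]
  \<comment> \<open>Length zero leaves a single letter from \<open>N\<close>, odd length is one
    palindrome, and positive even length is an odd product followed by its last letter.\<close>
  consider "k = 0" | j where "k = Suc (2 * j)" | j where "k = Suc (Suc (2 * j))"
    by (metis evenE not0_implies_Suc oddE even_Suc Suc_eq_plus1)
  then show "\<exists>ps \<in> lists (almost_palindromes G S m). length ps \<le> 2 \<and> list_product G ps = g"
  proof cases
    case 1
    then have "palindrome_word G S [n]" "list_product G [n] = g"
      using n carr by (auto simp: S g list_product_def intro: palindrome_word_single)
    then have "g \<in> almost_palindromes G S m"
      using palindrome_almost_palindrome S_carrier by metis
    then show ?thesis
      using \<open>g \<in> carrier G\<close> by (intro bexI[of _ "[g]"]) (auto simp: list_product_def)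
  next
    case (2 j)
    then have "g \<in> almost_palindromes G S m"
      using odd[of j] palindrome_almost_palindrome S_carrier g by metis
    then show ?thesis
      using \<open>g \<in> carrier G\<close> by (intro bexI[of _ "[g]"]) (auto simp: list_product_def)
  next
    case (3 j)
    let ?q = "n \<otimes> alternating_product G (Suc (2 * j)) x y"
    have "?q \<in> almost_palindromes G S m"
      using odd[of j] palindrome_almost_palindrome S_carrier by metis
    moreover have "y \<in> almost_palindromes G S m"
      using palindrome_almost_palindrome[OF palindrome_word_single[OF xyS(2)] S_carrier] carr
      by (simp add: list_product_def)
    moreover have "g = ?q \<otimes> y"
      using alternating_product_snoc[OF carr(2,3), of "Suc (2 * j)"] carr
      by (simp add: g 3 m_assoc)
    ultimately show ?thesis
      using carr by (intro bexI[of _ "[?q, y]"]) (auto simp: list_product_def)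
  qed
qed

subsection \<open>Subgroups of index two\<close>

text \<open>Pigeonhole: \<open>H\<close> differs from both \<open>H x\<close> and
  \<open>H (inv y)\<close>, and with at most two cosets these must coincide. The inverse is chosen
  so that the coincidence says \<open>x y\<close> is in \<open>H\<close>.\<close>

lemma index_two_mult:
  assumes H: "subgroup H G" and fin: "finite (rcosets H)" and card: "card (rcosets H) \<le> 2"
    and x: "x \<in> carrier G" "x \<notin> H" and y: "y \<in> carrier G" "y \<notin> H"
  shows "x \<otimes> y \<in> H"
proof -
  have cosets: "{H, H #> x, H #> inv y} \<subseteq> rcosets H"
    using H x y subgroup.subgroup_in_rcosets[OF H is_group] by (auto simp: RCOSETS_def)
  have "H \<noteq> H #> x" "H \<noteq> H #> inv y"
    using x y rcos_self[OF _ H] subgroup.m_inv_closed[OF H, of "inv y"] inv_closed inv_inv by metis+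
  moreover have "card {H, H #> x, H #> inv y} \<le> 2"
    using card_mono[OF fin cosets] card by simp
  ultimately have "H #> x = H #> inv y"
    by (cases "H #> x = H #> inv y") auto
  then have "x \<in> H #> inv y"
    using rcos_self[OF x(1) H] by simp
  then obtain h where h: "h \<in> H" "x = h \<otimes> inv y"
    by (auto simp: r_coset_def)
  then have "x \<otimes> y = h"
    using y subgroup.mem_carrier[OF H] by (simp add: m_assoc)
  then show ?thesis using h by simp
qed

text \<open>For \<open>x\<close> outside \<open>H\<close>, both \<open>x h\<close> and
  \<open>inv x\<close> lie outside \<open>H\<close>, so their product lies in \<open>H\<close> by
  \<open>index_two_mult\<close>.\<close>

lemma index_two_normal:
  assumes H: "subgroup H G" and fin: "finite (rcosets H)" and card: "card (rcosets H) \<le> 2"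
  shows "H \<lhd> G"
  unfolding normal_inv_iff
proof (intro conjI ballI H)
  fix x h assume x: "x \<in> carrier G" and h: "h \<in> H"
  interpret H: subgroup H G by fact
  show "x \<otimes> h \<otimes> inv x \<in> H"
  proof (cases "x \<in> H")
    case False
    have "x \<otimes> h \<notin> H"
    proof
      assume "x \<otimes> h \<in> H"
      then have "x \<otimes> h \<otimes> inv h \<in> H" using h by blast
      then show False using False x h by (simp add: m_assoc)
    qed
    moreover have "inv x \<notin> H"
      using False x H.m_inv_closed[of "inv x"] by auto
    ultimately show ?thesis
      using index_two_mult[OF H fin card] x h by simp
  qed (use h in blast)
qed

text \<open>Conjugation by a product is a composition of conjugations, so invariance under an
  inverse-closed generating set suffices. In the amalgam this reduces normality to the two
  factors.\<close>

lemma normal_generateI: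
  assumes N: "subgroup N G" and gen: "generate G S = carrier G"
    and inv_S: "\<And>s. s \<in> S \<Longrightarrow> inv s \<in> S"
    and conj: "\<And>s n. \<lbrakk>s \<in> S; n \<in> N\<rbrakk> \<Longrightarrow> s \<otimes> n \<otimes> inv s \<in> N"
  shows "N \<lhd> G"
proof -
  interpret N: subgroup N G by fact
  have "\<forall>n \<in> N. g \<otimes> n \<otimes> inv g \<in> N" if "g \<in> generate G S" for g
    using that
  proof induction
    case (eng g1 g2)
    then have "g1 \<in> carrier G" "g2 \<in> carrier G" using gen by auto
    then have "g1 \<otimes> g2 \<otimes> n \<otimes> inv (g1 \<otimes> g2) = g1 \<otimes> (g2 \<otimes> n \<otimes> inv g2) \<otimes> inv g1" if "n \<in> N" for n
      using that by (simp add: inv_mult_group m_assoc)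
    then show ?case using eng.IH by simp
  qed (use conj inv_S in auto)
  then show ?thesis
    using N gen by (simp add: normal_inv_iff)
qed

end

section \<open>Transfer from the factors to the amalgam\<close>

lemma hom_image_r_coset:
  assumes "f \<in> hom G K" "H \<subseteq> carrier G" "x \<in> carrier G"
  shows "f ` (H #>\<^bsub>G\<^esub> x) = (f ` H) #>\<^bsub>K\<^esub> f x"
  using assms by (force simp: r_coset_def hom_mult subset_iff)

text \<open>Since \<open>inv a\<close> is outside \<open>H\<close> as well,
  \<open>index_two_mult\<close> puts \<open>x (inv a)\<close> into \<open>H\<close> for each
  \<open>x\<close> outside \<open>H\<close>.\<close>

lemma (in group) carrier_index_two:
  assumes H: "subgroup H G" and fin: "finite (rcosets H)" and card: "card (rcosets H) \<le> 2"
    and a: "a \<in> carrier G" "a \<notin> H"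
  shows "carrier G = H \<union> (H #> a)"
proof
  interpret H: subgroup H G by fact
  have "inv a \<notin> H" using a H.m_inv_closed[of "inv a"] by auto
  then have "x \<otimes> inv a \<in> H" if "x \<in> carrier G" "x \<notin> H" for x
    using index_two_mult[OF H fin card that] a by simp
  moreover have "x = (x \<otimes> inv a) \<otimes> a" if "x \<in> carrier G" for x
    using that a by (simp add: m_assoc)
  ultimately show "carrier G \<subseteq> H \<union> (H #> a)"
    unfolding r_coset_def by blast
  show "H \<union> (H #> a) \<subseteq> carrier G"
    using a by (auto simp: r_coset_def)
qed

text \<open>This covers conjugation by elements of the image of \<open>f\<close>; applied to both
  embeddings of factors, it supplies the hypothesis of \<open>normal_generateI\<close>.\<close>

lemma hom_image_conj:
  assumes "group_hom G K f" "N \<lhd> G" "x \<in> carrier G" "n \<in> f ` N"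
  shows "f x \<otimes>\<^bsub>K\<^esub> n \<otimes>\<^bsub>K\<^esub> inv\<^bsub>K\<^esub> f x \<in> f ` N"
proof -
  interpret group_hom G K f by fact
  interpret N: normal N G by fact
  obtain l where l: "l \<in> N" "n = f l" using assms(4) by blast
  then have "f x \<otimes>\<^bsub>K\<^esub> n \<otimes>\<^bsub>K\<^esub> inv\<^bsub>K\<^esub> f x = f (x \<otimes>\<^bsub>G\<^esub> l \<otimes>\<^bsub>G\<^esub> inv\<^bsub>G\<^esub> x)"
    using assms(3) by simp
  then show ?thesis using assms(3) l N.inv_op_closed2 by blast
qed

theorem corollary1p4:
  fixes G1 :: "('a, 'c) monoid_scheme" and G2 :: "('b, 'd) monoid_scheme"
    and H1 :: "'a set" and H2 :: "'b set" and \<phi> :: "'a \<Rightarrow> 'b" and m :: nat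
  assumes "group G1" and "group G2"
    and "subgroup H1 G1" and "subgroup H2 G2"
    and "\<phi> \<in> iso (G1\<lparr>carrier := H1\<rparr>) (G2\<lparr>carrier := H2\<rparr>)"
    and "H1 \<noteq> carrier G1" and "H2 \<noteq> carrier G2"
    and "finite (rcosets\<^bsub>G1\<^esub> H1)" and "card (rcosets\<^bsub>G1\<^esub> H1) \<le> 2"
    and "finite (rcosets\<^bsub>G2\<^esub> H2)" and "card (rcosets\<^bsub>G2\<^esub> H2) \<le> 2"
  shows "almost_palindromic_width (amalgamated_product G1 G2 H1 \<phi>)
           (amalg_factors G1 G2 H1 \<phi>) m < \<infinity>"
proof -
  interpret G1: group G1 by fact
  interpret G2: group G2 by fact
  interpret H1: normal H1 G1
    by (rule G1.index_two_normal) fact+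
  interpret H2: normal H2 G2
    by (rule G2.index_two_normal) fact+
  let ?G = "amalgamated_product G1 G2 H1 \<phi>"
  let ?S = "amalg_factors G1 G2 H1 \<phi>"
  let ?i1 = "amalg_in1 G1 G2 H1 \<phi>"
  let ?i2 = "amalg_in2 G1 G2 H1 \<phi>"
  interpret G: group ?G
    by (rule group_amalgamated_product) fact+
  interpret i1: group_hom G1 ?G ?i1
    by unfold_locales (rule amalg_in1_hom[OF assms(1)])
  interpret i2: group_hom G2 ?G ?i2
    by unfold_locales (rule amalg_in2_hom[OF assms(2)])
  have \<phi>_image: "\<phi> ` H1 = H2"
    using assms(5) by (auto simp: iso_def bij_betw_def)
  then have "\<phi> ` H1 \<subseteq> carrier G2"
    using H2.subset by blast
  note identified = amalg_in_identified[OF _ H1.subset this]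
  define N where "N = ?i1 ` H1"
  \<comment> \<open>The amalgamation makes \<open>N\<close> the image of both subgroups, so each
    factor can be used to conjugate it.\<close>
  have N2: "N = ?i2 ` H2"
    using identified by (force simp: N_def \<phi>_image[symmetric])
  \<comment> \<open>Properness of the subgroups provides \<open>a\<close> and \<open>b\<close>,
    which represent the nontrivial coset in each factor.\<close>
  obtain a where a: "a \<in> carrier G1" "a \<notin> H1"
    using assms(6) H1.subset by blast
  obtain b where b: "b \<in> carrier G2" "b \<notin> H2"
    using assms(7) H2.subset by blast
  have gen: "generate ?G ?S = carrier ?G"
    by (rule amalg_generate) fact+
  have inv_S: "inv\<^bsub>?G\<^esub> s \<in> ?S" if "s \<in> ?S" for s
    using that unfolding amalg_factors_def
    by (elim UnE imageE) (simp_all flip: i1.hom_inv i2.hom_inv)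
  have S: "?S = N \<union> (N #>\<^bsub>?G\<^esub> ?i1 a) \<union> (N #>\<^bsub>?G\<^esub> ?i2 b)"
  proof -
    have "?i1 ` carrier G1 = N \<union> (N #>\<^bsub>?G\<^esub> ?i1 a)"
      using G1.carrier_index_two[OF assms(3,8,9) a] hom_image_r_coset[OF i1.homh H1.subset a(1)]
      by (simp add: N_def image_Un)
    moreover have "?i2 ` carrier G2 = N \<union> (N #>\<^bsub>?G\<^esub> ?i2 b)"
      using G2.carrier_index_two[OF assms(4,10,11) b] hom_image_r_coset[OF i2.homh H2.subset b(1)]
      by (simp add: N2 image_Un)
    ultimately show ?thesis
      unfolding amalg_factors_def by blast
  qed
  have "N \<lhd> ?G"
  proof (rule G.normal_generateI[OF _ gen inv_S])
    show "subgroup N ?G"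
      unfolding N_def by (rule i1.subgroup_img_is_subgroup) fact
    fix s n assume "s \<in> ?S" "n \<in> N"
    then show "s \<otimes>\<^bsub>?G\<^esub> n \<otimes>\<^bsub>?G\<^esub> inv\<^bsub>?G\<^esub> s \<in> N"
      using hom_image_conj[OF i1.group_hom_axioms H1.normal_axioms]
        hom_image_conj[OF i2.group_hom_axioms H2.normal_axioms]
      unfolding amalg_factors_def N_def[symmetric] N2[symmetric] by blast
  qed
  moreover have "?i1 a \<otimes>\<^bsub>?G\<^esub> ?i1 a \<in> N"
    using G1.index_two_mult[OF assms(3,8,9) a a] a by (simp add: N_def flip: i1.hom_mult)
  moreover have "?i2 b \<otimes>\<^bsub>?G\<^esub> ?i2 b \<in> N"
    using G2.index_two_mult[OF assms(4,10,11) b b] b by (simp add: N2 flip: i2.hom_mult)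
  \<comment> \<open>A homomorphism separates \<open>a b\<close> from \<open>N\<close>: the quotient
    map to \<open>G1 Mod H1\<close> on the first factor and the trivial map on the second agree on
    the amalgamated subgroup. The induced map kills \<open>N\<close> but sends \<open>a b\<close> to
    the coset of \<open>a\<close>, which is nontrivial.\<close>
  moreover have "?i1 a \<otimes>\<^bsub>?G\<^esub> ?i2 b \<notin> N"
  proof
    assume ab: "?i1 a \<otimes>\<^bsub>?G\<^esub> ?i2 b \<in> N"
    let ?Q = "G1 Mod H1"
    interpret Q: group ?Q by (rule H1.factorgroup_is_group)
    have one: "H1 #>\<^bsub>G1\<^esub> h = \<one>\<^bsub>?Q\<^esub>" if "h \<in> H1" for h
      using that by (simp add: FactGroup_def G1.coset_join2 H1.subgroup_axioms)
    have "\<exists>f \<in> hom ?G ?Q. (\<forall>x \<in> carrier G1. f (?i1 x) = H1 #>\<^bsub>G1\<^esub> x)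
        \<and> (\<forall>y \<in> carrier G2. f (?i2 y) = \<one>\<^bsub>?Q\<^esub>)"
    proof (rule amalg_universal[OF assms(1,2) Q.is_group H1.r_coset_hom_Mod])
      show "(\<lambda>_. \<one>\<^bsub>?Q\<^esub>) \<in> hom G2 ?Q"
        by (rule homI) (simp_all only: Q.one_closed Q.l_one)
    qed (use one H1.subset \<phi>_image H2.subset in auto)
    then obtain f where f: "f \<in> hom ?G ?Q" "\<And>x. x \<in> carrier G1 \<Longrightarrow> f (?i1 x) = H1 #>\<^bsub>G1\<^esub> x"
        "\<And>y. y \<in> carrier G2 \<Longrightarrow> f (?i2 y) = \<one>\<^bsub>?Q\<^esub>"
      by blast
    have "H1 #>\<^bsub>G1\<^esub> a \<in> carrier ?Q"
      using f(1,2) a by (metis hom_in_carrier i1.hom_closed)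
    then have "f (?i1 a \<otimes>\<^bsub>?G\<^esub> ?i2 b) = H1 #>\<^bsub>G1\<^esub> a"
      using a b by (simp only: hom_mult[OF f(1)] i1.hom_closed i2.hom_closed f(2,3) Q.r_one)
    \<comment> \<open>The identity of \<open>G1 Mod H1\<close> is the set \<open>H1\<close>
      itself.\<close>
    moreover have "f (?i1 a \<otimes>\<^bsub>?G\<^esub> ?i2 b) = H1"
      using ab f(2) one by (auto simp: N_def FactGroup_def)
    ultimately have "a \<in> H1"
      using G1.rcos_self[OF a(1) H1.subgroup_axioms] by simp
    then show False using a by simp
  qed
  ultimately have "almost_palindromic_width ?G ?S m \<le> enat 2"
    using a b S gen inv_S by (intro G.almost_palindromic_width_le_2) auto
  then show ?thesis
    by (rule order.strict_trans1) simp
qed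

end
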